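(* Let $2\le r\le k$ and $C\ge 1$ be integers. Let $\mathcal{H}_N$ be a sequence of (possibly weighted) $k$-uniform hypergraphs with $V(\mathcal{H}_N)=[N]$, $\Delta_r(\mathcal{H}_N)\le C$ and $\sigma^2(\mathcal{H}_N)\ge N^{2r-2}/C$ for all $N$. Then for every sequence $p=p_N\in(0,1/2)$ which is either a constant in $(0,1/2)$ or converges to $0$ while satisfying $p\gg(\log N/N)^{(r-1)/(k-1)}$, we have $$\frac{D^{\mathcal{H}_N}(B_p)}{(1-p)^{1/2}\,p^{k-1/2}\,\big(\bar d(\mathcal{H}_N)^2+\sigma^2(\mathcal{H}_N)\big)^{1/2}N^{1/2}}\ \longrightarrow\ N(0,1)$$ in distribution as $N\to\infty$, where $N(0,1)$ is the standard normal distribution.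
   Context: $[N]=\{1,\dots,N\}$. Sequences are indexed by $N$ (all sufficiently large positive integers), and asymptotics are as $N\to\infty$: $a_N\gg b_N$ means $b_N/a_N\to 0$. A weighted $k$-uniform hypergraph $\mathcal{H}$ on $[N]$ has a positive weight attached to each edge (unweighted: all weights $1$); all parameters count edges with weight. $e(\mathcal{H})$ is the total weight of all edges; for $R\subseteq[N]$, $d_{\mathcal{H}}(R)$ is the total weight of edges containing $R$, and $d_{\mathcal{H}}(x)=d_{\mathcal{H}}(\{x\})$. Set $\Delta_r(\mathcal{H})=\max\{d_{\mathcal{H}}(R):|R|=r\}$, $\bar d(\mathcal{H})=\frac1N\sum_{x=1}^N d_{\mathcal{H}}(x)$, and $\sigma^2(\mathcal{H})=\frac1N\sum_{x=1}^N (d_{\mathcal{H}}(x)-\bar d(\mathcal{H}))^2$. $B_p\subseteq[N]$ is the random set in which each element of $[N]$ is included independently with probability $p$. For $B\subseteq[N]$, $N^{\mathcal{H}}(B)$ is the total weight of edges of $\mathcal{H}$ contained in $B$, and $D^{\mathcal{H}}(B_p)=N^{\mathcal{H}}(B_p)-p^k e(\mathcal{H})$. *)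

theory Defs
  imports "HOL-Probability.Probability"
begin

text \<open>
  The weight function is total on sets of vertices; only its values on the edges are ever used.
\<close>

record 'a weighted_hypergraph =
  verts :: "'a set"
  edges :: "'a set set"
  weight :: "'a set \<Rightarrow> real"

definition uniform_hypergraph :: "nat \<Rightarrow> 'a weighted_hypergraph \<Rightarrow> bool" where
  "uniform_hypergraph k H \<longleftrightarrow>
     finite (verts H) \<and>
     (\<forall>e\<in>edges H. e \<subseteq> verts H \<and> card e = k \<and> weight H e > 0)"

definition total_weight :: "'a weighted_hypergraph \<Rightarrow> real" where
  "total_weight H = (\<Sum>e\<in>edges H. weight H e)"

definition set_degree :: "'a weighted_hypergraph \<Rightarrow> 'a set \<Rightarrow> real" where
  "set_degree H R = (\<Sum>e | e \<in> edges H \<and> R \<subseteq> e. weight H e)"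

abbreviation degree :: "'a weighted_hypergraph \<Rightarrow> 'a \<Rightarrow> real" where
  "degree H x \<equiv> set_degree H {x}"

text \<open>
  The maximum is meaningful only when there are at least \<open>r\<close> vertices.
\<close>

definition max_degree :: "nat \<Rightarrow> 'a weighted_hypergraph \<Rightarrow> real" where
  "max_degree r H = Max (set_degree H ` {R. R \<subseteq> verts H \<and> card R = r})"

definition avg_degree :: "'a weighted_hypergraph \<Rightarrow> real" where
  "avg_degree H = (\<Sum>x\<in>verts H. degree H x) / real (card (verts H))"

definition degree_variance :: "'a weighted_hypergraph \<Rightarrow> real" where
  "degree_variance H =
     (\<Sum>x\<in>verts H. (degree H x - avg_degree H)\<^sup>2) / real (card (verts H))"

definition random_subset :: "'a set \<Rightarrow> real \<Rightarrow> 'a set pmf" where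
  "random_subset V p =
     map_pmf (\<lambda>f. {x \<in> V. f x}) (Pi_pmf V False (\<lambda>_. bernoulli_pmf p))"

definition weight_within :: "'a weighted_hypergraph \<Rightarrow> 'a set \<Rightarrow> real" where
  "weight_within H B = (\<Sum>e | e \<in> edges H \<and> e \<subseteq> B. weight H e)"

text \<open>
  For a \<open>k\<close>-uniform \<open>H\<close>, the subtracted term is the expectation of \<open>weight_within H\<close>
  under \<open>random_subset (verts H) p\<close>.
\<close>

definition deviation :: "nat \<Rightarrow> real \<Rightarrow> 'a weighted_hypergraph \<Rightarrow> 'a set \<Rightarrow> real" where
  "deviation k p H B = weight_within H B - p ^ k * total_weight H"

end

theory Submission
  imports Defs
begin

text \<open>
  With \<open>Y\<^sub>x\<close> the centred indicator of \<open>x \<in> B\<^sub>p\<close>, the deviation expands as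
  \<open>\<Sum>S. p\<^bsup>k-|S|\<^esup> d(S) \<Prod>x\<in>S. Y\<^sub>x\<close> over the nonempty sets \<open>S\<close> of vertices, and the products are
  pairwise orthogonal. The singletons contribute a sum of independent variables whose variance is
  exactly the square of the norming factor; each summand is uniformly small after norming, so a
  Taylor expansion of the characteristic function shows that it is asymptotically normal. The sets with
  \<open>|S| \<ge> 2\<close> are negligible in \<open>L\<^sup>2\<close>: bounded \<open>r\<close>-degrees give \<open>d(S) \<le> C N\<^bsup>max(r-|S|,0)\<^esup>\<close>, and
  the condition on \<open>p\<close> forces \<open>pN \<longlongrightarrow> \<infinity>\<close> and \<open>p\<^bsup>k-1\<^esup> N\<^bsup>r-1\<^esup> \<longlongrightarrow> \<infinity>\<close>.
\<close>

section \<open>Independent Bernoulli variables\<close>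

abbreviation bernoulli_product :: "'a set \<Rightarrow> real \<Rightarrow> ('a \<Rightarrow> bool) pmf" where
  "bernoulli_product V p \<equiv> Pi_pmf V False (\<lambda>_. bernoulli_pmf p)"

lemma finite_set_bernoulli_product:
  assumes "finite V"
  shows "finite (set_pmf (bernoulli_product V p))"
  using assms by (simp add: set_Pi_pmf finite_PiE_dflt)

lemma integrable_bernoulli_product [simp]:
  fixes g :: "('a \<Rightarrow> bool) \<Rightarrow> 'b :: {banach, second_countable_topology}"
  assumes "finite V"
  shows "integrable (measure_pmf (bernoulli_product V p)) g"
  by (intro integrable_measure_pmf_finite finite_set_bernoulli_product assms)

text \<open>Independence turns the expectation into a product of two-point averages. The value field
  is left general because both a real instance (orthogonality) and a complex one (characteristic
  functions) are needed.\<close>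

lemma expectation_prod_bernoulli_product:
  fixes g :: "'a \<Rightarrow> bool \<Rightarrow> 'b :: {real_normed_field, banach, second_countable_topology}"
  assumes "finite V" and "0 \<le> p" "p \<le> 1"
  shows "measure_pmf.expectation (bernoulli_product V p) (\<lambda>f. \<Prod>x\<in>V. g x (f x)) =
           (\<Prod>x\<in>V. p *\<^sub>R g x True + (1 - p) *\<^sub>R g x False)"
proof -
  let ?M = "measure_pmf (bernoulli_product V p)"
  have indep: "prob_space.indep_vars ?M (\<lambda>_. borel) (\<lambda>x f. g x (f x)) V"
    by (rule prob_space.indep_vars_compose2[OF measure_pmf.prob_space_axioms indep_vars_Pi_pmf[OF assms(1)]]) simp
  have "(\<integral>f. (\<Prod>x\<in>V. g x (f x)) \<partial>?M) = (\<Prod>x\<in>V. \<integral>f. g x (f x) \<partial>?M)"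
    by (rule prob_space.indep_vars_lebesgue_integral[OF measure_pmf.prob_space_axioms assms(1) indep]) (simp add: assms(1))
  also have "\<dots> = (\<Prod>x\<in>V. p *\<^sub>R g x True + (1 - p) *\<^sub>R g x False)"
  proof (rule prod.cong[OF refl])
    fix x assume x: "x \<in> V"
    have "(\<integral>f. g x (f x) \<partial>?M) = (\<integral>b. g x b \<partial>map_pmf (\<lambda>f. f x) (bernoulli_product V p))"
      by simp
    also have "map_pmf (\<lambda>f. f x) (bernoulli_product V p) = bernoulli_pmf p"
      using Pi_pmf_component[OF assms(1), of x False "\<lambda>_. bernoulli_pmf p"] x by simp
    also have "(\<integral>b. g x b \<partial>bernoulli_pmf p) = p *\<^sub>R g x True + (1 - p) *\<^sub>R g x False"
      using assms by (subst integral_measure_pmf[of UNIV]) (auto simp: UNIV_bool)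
    finally show "(\<integral>f. g x (f x) \<partial>?M) = \<dots>" .
  qed
  finally show ?thesis .
qed

text \<open>These are the p-biased Fourier-Walsh characters without their normalisation: dividing by
  \<open>(p * (1 - p)) powr (card S / 2)\<close> would make them orthonormal for
  \<open>0 < p < 1\<close>.\<close>

definition centered_monomial :: "real \<Rightarrow> 'a set \<Rightarrow> ('a \<Rightarrow> bool) \<Rightarrow> real" where
  "centered_monomial p S f = (\<Prod>x\<in>S. of_bool (f x) - p)"

text \<open>The expectation factorises over the vertices. A vertex in exactly one of
  \<open>S\<close> and \<open>T\<close> gives the mean 0 of a centred variable; a vertex in both
  gives the variance \<open>p * (1 - p)\<close>.\<close>

lemma expectation_centered_monomial_mult:
  assumes "finite V" "0 \<le> p" "p \<le> 1" "S \<subseteq> V" "T \<subseteq> V"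
  shows "measure_pmf.expectation (bernoulli_product V p)
           (\<lambda>f. centered_monomial p S f * centered_monomial p T f) =
         (if S = T then (p * (1 - p)) ^ card S else 0)"
proof -
  let ?y = "\<lambda>x b. of_bool b - p"
  let ?g = "\<lambda>x b. (if x \<in> S then ?y x b else 1) * (if x \<in> T then ?y x b else 1)"
  let ?h = "\<lambda>x. p *\<^sub>R ?g x True + (1 - p) *\<^sub>R ?g x False"
  \<comment> \<open>Padding with factors 1 lets both monomials run over all of \<open>V\<close>, as
    the product formula requires.\<close>
  have restrict: "centered_monomial p U f = (\<Prod>x\<in>V. if x \<in> U then ?y x (f x) else 1)"
    if "U \<subseteq> V" for U f
    using that assms(1) unfolding centered_monomial_def
    by (subst prod.inter_restrict[symmetric]) (auto simp: Int_absorb1)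
  have "measure_pmf.expectation (bernoulli_product V p)
           (\<lambda>f. centered_monomial p S f * centered_monomial p T f) = (\<Prod>x\<in>V. ?h x)"
    unfolding restrict[OF assms(4)] restrict[OF assms(5)] prod.distrib[symmetric]
    by (rule expectation_prod_bernoulli_product) (use assms in auto)
  also have "\<dots> = (if S = T then (p * (1 - p)) ^ card S else 0)"
  proof (cases "S = T")
    case True
    have "(\<Prod>x\<in>V. ?h x) = (\<Prod>x\<in>V. if x \<in> S then p * (1 - p) else 1)"
      using True by (intro prod.cong) (auto simp: algebra_simps)
    also have "\<dots> = (p * (1 - p)) ^ card S"
      using assms by (subst prod.inter_restrict[symmetric]) (auto simp: Int_absorb1)
    finally show ?thesis using True by simp
  next
    case False
    then obtain x where x: "x \<in> V" "(x \<in> S) \<noteq> (x \<in> T)" using assms by blast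
    then have "?h x = 0" by (cases "x \<in> S") (auto simp: algebra_simps)
    then have "(\<Prod>x\<in>V. ?h x) = 0" using x(1) assms(1) by (meson prod_zero)
    then show ?thesis using False by simp
  qed
  finally show ?thesis .
qed

text \<open>Parseval's identity: after squaring out, orthogonality leaves only the diagonal
  terms.\<close>

lemma expectation_centered_polynomial_square:
  fixes c :: "'a set \<Rightarrow> real"
  assumes "finite V" "0 \<le> p" "p \<le> 1" "F \<subseteq> Pow V"
  shows "measure_pmf.expectation (bernoulli_product V p)
           (\<lambda>f. (\<Sum>S\<in>F. c S * centered_monomial p S f)\<^sup>2) =
         (\<Sum>S\<in>F. (c S)\<^sup>2 * (p * (1 - p)) ^ card S)"
proof -
  have fin: "finite F" using assms finite_subset by blast
  have "measure_pmf.expectation (bernoulli_product V p)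
           (\<lambda>f. (\<Sum>S\<in>F. c S * centered_monomial p S f)\<^sup>2) =
        measure_pmf.expectation (bernoulli_product V p)
           (\<lambda>f. \<Sum>S\<in>F. \<Sum>T\<in>F. (c S * c T) * (centered_monomial p S f * centered_monomial p T f))"
    by (simp add: power2_eq_square sum_product mult_ac)
  also have "\<dots> = (\<Sum>S\<in>F. measure_pmf.expectation (bernoulli_product V p)
           (\<lambda>f. \<Sum>T\<in>F. (c S * c T) * (centered_monomial p S f * centered_monomial p T f)))"
    by (rule Bochner_Integration.integral_sum) (rule integrable_bernoulli_product[OF assms(1)])
  also have "\<dots> = (\<Sum>S\<in>F. \<Sum>T\<in>F. measure_pmf.expectation (bernoulli_product V p)
           (\<lambda>f. (c S * c T) * (centered_monomial p S f * centered_monomial p T f)))"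
    by (intro sum.cong refl Bochner_Integration.integral_sum integrable_bernoulli_product assms(1))
  also have "\<dots> = (\<Sum>S\<in>F. \<Sum>T\<in>F. (c S * c T) * (if S = T then (p * (1 - p)) ^ card S else 0))"
  proof (intro sum.cong refl)
    fix S T assume "S \<in> F" "T \<in> F"
    then have "S \<subseteq> V" "T \<subseteq> V" using assms(4) by auto
    then show "measure_pmf.expectation (bernoulli_product V p)
           (\<lambda>f. (c S * c T) * (centered_monomial p S f * centered_monomial p T f)) =
        (c S * c T) * (if S = T then (p * (1 - p)) ^ card S else 0)"
      by (simp only: integral_mult_right_zero expectation_centered_monomial_mult[OF assms(1-3)])
  qed
  also have "\<dots> = (\<Sum>S\<in>F. (c S)\<^sup>2 * (p * (1 - p)) ^ card S)"
    using fin by (simp add: if_distrib[of "\<lambda>z. _ * z"] sum.delta power2_eq_square cong: if_cong)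
  finally show ?thesis .
qed

section \<open>Characteristic functions\<close>

text \<open>The variable with values \<open>1 - p\<close> and \<open>- p\<close> has mean 0 and
  variance \<open>v = p * (1 - p)\<close>, so its characteristic function and the Gaussian one both
  start with \<open>1 - s^2 * v / 2\<close>. The two error terms are the remainders of these
  expansions. Each is kept proportional to \<open>v\<close>, so that errors of many variables can be
  added up.\<close>

lemma two_point_char_approx:
  fixes s p :: real
  assumes "0 \<le> p" "p \<le> 1"
  shows "cmod (p *\<^sub>R iexp (s * (1 - p)) + (1 - p) *\<^sub>R iexp (s * (- p)) - exp (- (s\<^sup>2 * (p * (1 - p)) / 2)))
    \<le> \<bar>s\<bar> ^ 3 * (p * (1 - p)) / 6 + s ^ 4 * (p * (1 - p)) / 4"
proof -
  define E where "E u = iexp u - (1 + \<i> * u - u\<^sup>2 / 2)" for u :: real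
  define v where "v = p * (1 - p)"
  define w where "w = s\<^sup>2 * v / 2"
  have v: "0 \<le> v" "v \<le> 1" using assms by (auto simp: v_def mult_le_one)
  have E: "cmod (E u) \<le> \<bar>u\<bar> ^ 3 / 6" for u
    using iexp_approx1[of u 2]
    by (simp add: E_def numeral_2_eq_2 numeral_3_eq_3 power_mult_distrib algebra_simps fact_numeral)
  \<comment> \<open>Mean zero cancels the linear terms, and the quadratic terms combine to
    \<open>w\<close>.\<close>
  have eq: "p *\<^sub>R iexp (s * (1 - p)) + (1 - p) *\<^sub>R iexp (s * (- p)) - exp (- w) =
      (p *\<^sub>R E (s * (1 - p)) + (1 - p) *\<^sub>R E (s * (- p))) + of_real (1 - w - exp (- w))"
    by (simp add: E_def w_def v_def scaleR_conv_of_real power2_eq_square field_simps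
             flip: exp_of_real)
  have "cmod (p *\<^sub>R E (s * (1 - p)) + (1 - p) *\<^sub>R E (s * (- p)))
      \<le> p * (\<bar>s * (1 - p)\<bar> ^ 3 / 6) + (1 - p) * (\<bar>s * (- p)\<bar> ^ 3 / 6)"
    using assms mult_left_mono[OF E[of "s * (1 - p)"], of p] mult_left_mono[OF E[of "s * (- p)"], of "1 - p"]
    by (intro norm_triangle_le add_mono) simp_all
  also have "\<dots> = \<bar>s\<bar> ^ 3 * v / 6 * ((1 - p)\<^sup>2 + p\<^sup>2)"
  proof -
    have "\<bar>s * (1 - p)\<bar> = \<bar>s\<bar> * (1 - p)" "\<bar>s * (- p)\<bar> = \<bar>s\<bar> * p"
      using assms by (simp_all add: abs_mult)
    then show ?thesis by (simp only: v_def) (simp add: field_simps power2_eq_square power3_eq_cube)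
  qed
  \<comment> \<open>The third absolute moment is thus \<open>v * (1 - 2 * v)\<close>, which is at
    most \<open>v\<close>.\<close>
  also have "(1 - p)\<^sup>2 + p\<^sup>2 = 1 - 2 * v"
    by (simp add: v_def power2_eq_square algebra_simps)
  also have "\<bar>s\<bar> ^ 3 * v / 6 * (1 - 2 * v) \<le> \<bar>s\<bar> ^ 3 * v / 6"
  proof (rule mult_right_le_one_le)
    have "1 - 2 * v = (1 - p)\<^sup>2 + p\<^sup>2"
      by (simp add: v_def power2_eq_square algebra_simps)
    then show "0 \<le> 1 - 2 * v" by simp
  qed (use v in auto)
  finally have 1: "cmod (p *\<^sub>R E (s * (1 - p)) + (1 - p) *\<^sub>R E (s * (- p))) \<le> \<bar>s\<bar> ^ 3 * v / 6" .
  have w: "0 \<le> w" using v by (simp add: w_def)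
  have "1 - w \<le> exp (- w)" using exp_ge_add_one_self[of "- w"] by simp
  moreover have "exp (- w) \<le> 1 - w + w\<^sup>2"
  proof -
    have "exp (- w) \<le> inverse (1 + w)"
      using w exp_ge_add_one_self[of w] by (simp add: exp_minus le_imp_inverse_le)
    \<comment> \<open>This holds because \<open>(1 + w) * (1 - w + w^2) = 1 + w^3\<close>.\<close>
    also have "\<dots> \<le> 1 - w + w\<^sup>2"
      using w by (simp add: field_simps power2_eq_square)
    finally show ?thesis .
  qed
  ultimately have "cmod (of_real (1 - w - exp (- w))) \<le> w\<^sup>2"
    unfolding norm_of_real by (simp add: abs_le_iff)
  also have "\<dots> = s ^ 4 * (v * v) / 4"
    by (simp add: w_def power2_eq_square power4_eq_xxxx)
  \<comment> \<open>One factor \<open>v \<le> 1\<close> is dropped to keep the bound linear in the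
    variance.\<close>
  also have "\<dots> \<le> s ^ 4 * v / 4"
    using v by (intro divide_right_mono mult_left_mono) (auto intro: mult_left_le)
  finally have 2: "cmod (of_real (1 - w - exp (- w))) \<le> s ^ 4 * v / 4" .
  show ?thesis
    using norm_triangle_mono[OF 1 2] unfolding v_def[symmetric] w_def[symmetric] eq .
qed

text \<open>A Lyapunov-type argument. Factors in the closed unit disc let the difference of two
  products be bounded by the sum of the factorwise differences. Each of these is at most a small
  constant times the variance of its summand, and the variances add up to 1.\<close>

lemma char_weighted_bernoulli_sum:
  fixes a :: "'a \<Rightarrow> real"
  assumes "finite V" "0 \<le> p" "p \<le> 1" "0 \<le> \<epsilon>"
    and small: "\<And>x. x \<in> V \<Longrightarrow> \<bar>a x\<bar> \<le> \<epsilon>"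
    and var: "(\<Sum>x\<in>V. (a x)\<^sup>2 * (p * (1 - p))) = 1"
  shows "cmod (char (distr (measure_pmf (bernoulli_product V p)) borel
             (\<lambda>f. \<Sum>x\<in>V. a x * (of_bool (f x) - p))) t - exp (- (t\<^sup>2 / 2)))
         \<le> \<bar>t\<bar> ^ 3 * \<epsilon> / 6 + t ^ 4 * \<epsilon>\<^sup>2 / 4"
proof -
  let ?v = "\<lambda>x. (a x)\<^sup>2 * (p * (1 - p))"
  let ?\<phi> = "\<lambda>x. p *\<^sub>R iexp (t * a x * (1 - p)) + (1 - p) *\<^sub>R iexp (t * a x * (- p))"
  let ?\<psi> = "\<lambda>x. complex_of_real (exp (- ((t * a x)\<^sup>2 * (p * (1 - p)) / 2)))"
  have "iexp (t * (\<Sum>x\<in>V. a x * (of_bool (f x) - p))) = (\<Prod>x\<in>V. iexp (t * a x * (of_bool (f x) - p)))" for f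
    using assms(1) by (simp add: exp_sum[symmetric] sum_distrib_left mult.assoc)
  then have "char (distr (measure_pmf (bernoulli_product V p)) borel
             (\<lambda>f. \<Sum>x\<in>V. a x * (of_bool (f x) - p))) t =
        measure_pmf.expectation (bernoulli_product V p)
             (\<lambda>f. \<Prod>x\<in>V. iexp (t * a x * (of_bool (f x) - p)))"
    unfolding char_def by (subst integral_distr) auto
  also have "\<dots> = (\<Prod>x\<in>V. ?\<phi> x)"
    using expectation_prod_bernoulli_product[OF assms(1-3),
        of "\<lambda>x b. iexp (t * a x * (of_bool b - p))"] by simp
  finally have char: "char (distr (measure_pmf (bernoulli_product V p)) borel
             (\<lambda>f. \<Sum>x\<in>V. a x * (of_bool (f x) - p))) t = (\<Prod>x\<in>V. ?\<phi> x)" .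
  have "(\<Sum>x\<in>V. - ((t * a x)\<^sup>2 * (p * (1 - p)) / 2)) = - (t\<^sup>2 / 2) * (\<Sum>x\<in>V. ?v x)"
    unfolding sum_distrib_left by (intro sum.cong) (auto simp: power_mult_distrib)
  \<comment> \<open>Total variance 1 lets the Gaussian split into one factor per vertex, with
    matching variances.\<close>
  then have gauss: "complex_of_real (exp (- (t\<^sup>2 / 2))) = (\<Prod>x\<in>V. ?\<psi> x)"
    using assms(1) by (simp add: var flip: of_real_prod exp_sum)
  have "cmod ((\<Prod>x\<in>V. ?\<phi> x) - (\<Prod>x\<in>V. ?\<psi> x)) \<le> (\<Sum>x\<in>V. cmod (?\<phi> x - ?\<psi> x))"
  proof (rule norm_prod_diff)
    fix x
    have "cmod (?\<phi> x) \<le> cmod (p *\<^sub>R iexp (t * a x * (1 - p))) + cmod ((1 - p) *\<^sub>R iexp (t * a x * (- p)))"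
      by (rule norm_triangle_ineq)
    also have "\<dots> = 1" using assms by (simp del: of_real_mult of_real_diff of_real_minus)
    finally show "cmod (?\<phi> x) \<le> 1" .
    show "cmod (?\<psi> x) \<le> 1" using assms by simp
  qed
  also have "\<dots> \<le> (\<Sum>x\<in>V. (\<bar>t\<bar> ^ 3 * \<epsilon> / 6 + t ^ 4 * \<epsilon>\<^sup>2 / 4) * ?v x)"
  proof (rule sum_mono)
    fix x assume x: "x \<in> V"
    have v: "0 \<le> ?v x" using assms by simp
    have cube: "\<bar>u\<bar> ^ 3 = \<bar>u\<bar> * u\<^sup>2" for u :: real
      by (simp add: power3_eq_cube power2_eq_square)
    \<comment> \<open>Two powers of \<open>a x\<close> are reserved for the variance; the remaining
      one or two are bounded by \<open>\<epsilon>\<close>.\<close>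
    have "\<bar>t * a x\<bar> ^ 3 * (p * (1 - p)) / 6 + (t * a x) ^ 4 * (p * (1 - p)) / 4 =
          \<bar>t\<bar> ^ 3 * \<bar>a x\<bar> / 6 * ?v x + t ^ 4 * \<bar>a x\<bar>\<^sup>2 / 4 * ?v x"
      unfolding cube by (simp add: abs_mult power_mult_distrib power2_eq_square power4_eq_xxxx mult_ac)
    also have "\<dots> \<le> \<bar>t\<bar> ^ 3 * \<epsilon> / 6 * ?v x + t ^ 4 * \<epsilon>\<^sup>2 / 4 * ?v x"
      using small[OF x] v
      by (intro add_mono mult_right_mono divide_right_mono mult_left_mono power_mono) auto
    finally show "cmod (?\<phi> x - ?\<psi> x) \<le> (\<bar>t\<bar> ^ 3 * \<epsilon> / 6 + t ^ 4 * \<epsilon>\<^sup>2 / 4) * ?v x"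
      using two_point_char_approx[OF assms(2,3), of "t * a x"] by (simp add: distrib_right)
  qed
  also have "\<dots> = \<bar>t\<bar> ^ 3 * \<epsilon> / 6 + t ^ 4 * \<epsilon>\<^sup>2 / 4"
    by (simp add: var flip: sum_distrib_left)
  finally show ?thesis unfolding char gauss .
qed

text \<open>A quantitative form of Slutsky's lemma: a remainder small in L2 barely moves the
  characteristic function, since \<open>u \<mapsto> iexp u\<close> is 1-Lipschitz and the first
  absolute moment is at most the L2 norm.\<close>

lemma char_perturbation:
  fixes X R :: "'a \<Rightarrow> real"
  assumes "finite (set_pmf M)"
  shows "cmod (char (distr (measure_pmf M) borel (\<lambda>f. X f + R f)) t
             - char (distr (measure_pmf M) borel X) t)
         \<le> \<bar>t\<bar> * sqrt (measure_pmf.expectation M (\<lambda>f. (R f)\<^sup>2))"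
proof -
  note int = integrable_measure_pmf_finite[OF assms]
  have "char (distr (measure_pmf M) borel (\<lambda>f. X f + R f)) t - char (distr (measure_pmf M) borel X) t
      = (CLINT f|M. iexp (t * (X f + R f)) - iexp (t * X f))"
    unfolding char_def by (simp add: integral_distr int)
  also have "cmod \<dots> \<le> (LINT f|M. cmod (iexp (t * (X f + R f)) - iexp (t * X f)))"
    by (rule integral_norm_bound)
  also have "\<dots> \<le> (LINT f|M. \<bar>t\<bar> * \<bar>R f\<bar>)"
  proof (rule integral_mono[OF int int])
    fix f
    have "iexp (t * (X f + R f)) - iexp (t * X f) = iexp (t * X f) * (iexp (t * R f) - 1)"
      by (simp add: algebra_simps exp_add[symmetric])
    also have "cmod \<dots> = cmod (iexp (t * R f) - 1)"
      by (simp add: norm_mult del: of_real_mult)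
    also have "\<dots> \<le> \<bar>t * R f\<bar>"
      using iexp_approx1[of "t * R f" 0] by simp
    finally show "cmod (iexp (t * (X f + R f)) - iexp (t * X f)) \<le> \<bar>t\<bar> * \<bar>R f\<bar>"
      by (simp add: abs_mult)
  qed
  also have "\<dots> = \<bar>t\<bar> * (LINT f|M. \<bar>R f\<bar>)" by simp
  \<comment> \<open>Cauchy-Schwarz, obtained from the nonnegative variance of
    \<open>\<bar>R f\<bar>\<close>.\<close>
  also have "(LINT f|M. \<bar>R f\<bar>) \<le> sqrt (LINT f|M. (R f)\<^sup>2)"
  proof (rule real_le_rsqrt)
    show "(LINT f|M. \<bar>R f\<bar>)\<^sup>2 \<le> (LINT f|M. (R f)\<^sup>2)"
      using measure_pmf.variance_positive[of M "\<lambda>f. \<bar>R f\<bar>"]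
        measure_pmf.variance_eq[of M "\<lambda>f. \<bar>R f\<bar>", OF int int] by simp
  qed
  finally show ?thesis by (simp add: mult_left_mono)
qed

section \<open>Degrees\<close>

lemma uniform_hypergraph_finite_edges:
  assumes "uniform_hypergraph k H"
  shows "finite (edges H)"
  using assms finite_subset[of "edges H" "Pow (verts H)"] unfolding uniform_hypergraph_def by auto

lemma set_degree_nonneg:
  assumes "uniform_hypergraph k H"
  shows "0 \<le> set_degree H S"
  using assms unfolding set_degree_def uniform_hypergraph_def by (intro sum_nonneg) (auto intro: less_imp_le)

lemma set_degree_antimono:
  assumes "uniform_hypergraph k H" "S \<subseteq> T"
  shows "set_degree H T \<le> set_degree H S"
  using assms uniform_hypergraph_finite_edges[OF assms(1)]
  unfolding set_degree_def uniform_hypergraph_def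
  by (intro sum_mono2) (auto intro: less_imp_le)

lemma set_degree_empty: "set_degree H {} = total_weight H"
  by (simp add: set_degree_def total_weight_def)

text \<open>Every edge containing \<open>S\<close> has \<open>k > card S\<close> vertices, hence at
  least one outside \<open>S\<close>, so the right-hand side counts it at least once.\<close>

lemma set_degree_le_sum_insert:
  assumes H: "uniform_hypergraph k H" and "S \<subseteq> verts H" and "card S < k"
  shows "set_degree H S \<le> (\<Sum>x\<in>verts H - S. set_degree H (insert x S))"
proof -
  have fin: "finite (edges H)" "finite (verts H)"
    using uniform_hypergraph_finite_edges[OF H] H by (auto simp: uniform_hypergraph_def)
  have w: "0 \<le> weight H e" if "e \<in> edges H" for e
    using H that by (auto simp: uniform_hypergraph_def less_imp_le)
  let ?E = "{e \<in> edges H. S \<subseteq> e}"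
  have "set_degree H S \<le> (\<Sum>e\<in>?E. \<Sum>x | x \<in> verts H - S \<and> x \<in> e. weight H e)"
    unfolding set_degree_def
  proof (rule sum_mono)
    fix e assume e: "e \<in> ?E"
    then have "card e = k" "e \<subseteq> verts H" using H by (auto simp: uniform_hypergraph_def)
    then have "S \<noteq> e" using assms(3) by auto
    then obtain x where x: "x \<in> verts H - S \<and> x \<in> e"
      using e \<open>e \<subseteq> verts H\<close> by blast
    then show "weight H e \<le> (\<Sum>x | x \<in> verts H - S \<and> x \<in> e. weight H e)"
      using fin w[of e] e by (intro member_le_sum[of x _ "\<lambda>_. weight H e"]) auto
  qed
  also have "\<dots> = (\<Sum>x\<in>verts H - S. \<Sum>e | e \<in> ?E \<and> x \<in> e. weight H e)"
    by (rule sum.swap_restrict) (use fin in auto)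
  also have "\<dots> = (\<Sum>x\<in>verts H - S. set_degree H (insert x S))"
    unfolding set_degree_def by (intro sum.cong) auto
  finally show ?thesis .
qed

text \<open>Each vertex that must be added to reach size \<open>r\<close> costs a factor of at most
  the number of vertices. From size \<open>r\<close> on, truncated subtraction makes the exponent 0
  and antimonotonicity gives the bound \<open>C\<close>.\<close>

lemma set_degree_le:
  assumes H: "uniform_hypergraph k H" and "r \<le> k" "0 \<le> C"
    and deg: "\<And>R. R \<subseteq> verts H \<Longrightarrow> card R = r \<Longrightarrow> set_degree H R \<le> C"
    and S: "S \<subseteq> verts H"
  shows "set_degree H S \<le> C * real (card (verts H)) ^ (r - card S)"
  using S
proof (induction "r - card S" arbitrary: S)
  case 0
  then have "r \<le> card S" by simp
  then obtain R where "R \<subseteq> S" "card R = r" by (rule obtain_subset_with_card_n)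
  then have "set_degree H S \<le> C"
    using deg[of R] set_degree_antimono[OF H, of R S] 0(2) by fastforce
  then show ?case using \<open>r \<le> card S\<close> by simp
next
  case (Suc m)
  let ?n = "real (card (verts H))"
  have fin: "finite (verts H)" "finite S"
    using H finite_subset[OF Suc.prems] by (auto simp: uniform_hypergraph_def)
  have "set_degree H S \<le> (\<Sum>x\<in>verts H - S. set_degree H (insert x S))"
    using Suc.hyps(2) assms(2) Suc.prems by (intro set_degree_le_sum_insert[OF H]) auto
  also have "\<dots> \<le> (\<Sum>x\<in>verts H - S. C * ?n ^ m)"
  proof (rule sum_mono)
    fix x assume x: "x \<in> verts H - S"
    then have "m = r - card (insert x S)" using Suc.hyps(2) fin by simp
    then show "set_degree H (insert x S) \<le> C * ?n ^ m"
      using Suc.hyps(1)[of "insert x S"] x Suc.prems by auto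
  qed
  also have "\<dots> \<le> ?n * (C * ?n ^ m)"
    using fin assms(3) by (auto intro!: mult_right_mono card_mono)
  finally show ?case by (simp add: Suc.hyps(2)[symmetric] mult_ac)
qed

text \<open>Double counting of pairs \<open>S \<subseteq> e\<close>: every edge has
  \<open>2 ^ k\<close> subsets.\<close>

lemma sum_set_degree:
  assumes H: "uniform_hypergraph k H"
  shows "(\<Sum>S\<in>Pow (verts H). set_degree H S) = 2 ^ k * total_weight H"
proof -
  have fin: "finite (edges H)" "finite (verts H)"
    using uniform_hypergraph_finite_edges[OF H] H by (auto simp: uniform_hypergraph_def)
  have "(\<Sum>S\<in>Pow (verts H). set_degree H S) =
      (\<Sum>e\<in>edges H. \<Sum>S | S \<in> Pow (verts H) \<and> S \<subseteq> e. weight H e)"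
    unfolding set_degree_def using fin by (intro sum.swap_restrict) auto
  also have "\<dots> = (\<Sum>e\<in>edges H. 2 ^ k * weight H e)"
  proof (rule sum.cong[OF refl])
    fix e assume "e \<in> edges H"
    then have "card e = k" "e \<subseteq> verts H" using H by (auto simp: uniform_hypergraph_def)
    then have "{S. S \<in> Pow (verts H) \<and> S \<subseteq> e} = Pow e" "card (Pow e) = 2 ^ k"
      using finite_subset[OF _ fin(2)] by (auto simp: card_Pow)
    then show "(\<Sum>S | S \<in> Pow (verts H) \<and> S \<subseteq> e. weight H e) = 2 ^ k * weight H e" by simp
  qed
  finally show ?thesis by (simp add: total_weight_def sum_distrib_left)
qed

text \<open>The second moment of the degrees is the squared mean plus the variance. This identifies
  the norming factor of the theorem with the standard deviation of the linear part.\<close>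

lemma sum_degree_square:
  assumes "finite (verts H)" "verts H \<noteq> {}"
  shows "(\<Sum>x\<in>verts H. (degree H x)\<^sup>2) =
    real (card (verts H)) * ((avg_degree H)\<^sup>2 + degree_variance H)"
proof -
  let ?n = "real (card (verts H))" and ?m = "avg_degree H"
  have n: "?n > 0" using assms by (simp add: card_gt_0_iff)
  have m: "(\<Sum>x\<in>verts H. degree H x) = ?n * ?m" using n by (simp add: avg_degree_def)
  have "?n * degree_variance H = (\<Sum>x\<in>verts H. (degree H x - ?m)\<^sup>2)"
    using n by (simp add: degree_variance_def)
  also have "\<dots> = (\<Sum>x\<in>verts H. (degree H x)\<^sup>2) - 2 * ?m * (\<Sum>x\<in>verts H. degree H x) + ?n * ?m\<^sup>2"
    by (simp add: power2_diff sum.distrib sum_subtractf sum_distrib_left mult_ac)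
  finally show ?thesis by (simp add: m algebra_simps power2_eq_square)
qed

section \<open>Orthogonal decomposition of the deviation\<close>

text \<open>The indicator that an edge \<open>e\<close> survives is the product over
  \<open>e\<close> of (centred indicator + p). Expanding it over the subsets \<open>S\<close> of
  \<open>e\<close> and exchanging the sums collects the weights of the edges above \<open>S\<close>
  into \<open>set_degree H S\<close>.\<close>

lemma weight_within_decomposition:
  assumes H: "uniform_hypergraph k H"
  shows "weight_within H {x \<in> verts H. f x} =
    (\<Sum>S\<in>Pow (verts H). p ^ (k - card S) * set_degree H S * centered_monomial p S f)"
proof -
  have fin: "finite (edges H)" "finite (verts H)"
    using uniform_hypergraph_finite_edges[OF H] H by (auto simp: uniform_hypergraph_def)
  have "weight_within H {x \<in> verts H. f x} =
      (\<Sum>e\<in>edges H. if e \<subseteq> {x \<in> verts H. f x} then weight H e else 0)"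
    unfolding weight_within_def using fin by (simp add: sum.inter_filter)
  also have "\<dots> = (\<Sum>e\<in>edges H. \<Sum>S | S \<in> Pow (verts H) \<and> S \<subseteq> e.
        weight H e * (p ^ (k - card S) * centered_monomial p S f))"
  proof (rule sum.cong[OF refl])
    fix e assume "e \<in> edges H"
    then have e: "card e = k" "e \<subseteq> verts H" "finite e"
      using H finite_subset[OF _ fin(2)] by (auto simp: uniform_hypergraph_def)
    have "(if e \<subseteq> {x \<in> verts H. f x} then weight H e else 0) = weight H e * (\<Prod>x\<in>e. of_bool (f x))"
    proof (cases "\<forall>x\<in>e. f x")
      case False
      then have "(\<Prod>x\<in>e. of_bool (f x)) = (0::real)" using e by (intro prod_zero) auto
      then show ?thesis using False by auto
    qed (use e in auto)
    also have "(\<Prod>x\<in>e. of_bool (f x)) = (\<Prod>x\<in>e. (of_bool (f x) - p) + p)" by simp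
    also have "\<dots> = (\<Sum>S\<in>Pow e. (\<Prod>x\<in>S. of_bool (f x) - p) * (\<Prod>x\<in>e - S. p))"
      by (rule prod_add) (rule e)
    also have "\<dots> = (\<Sum>S\<in>Pow e. p ^ (k - card S) * centered_monomial p S f)"
      using e finite_subset[OF _ e(3)]
      by (intro sum.cong) (auto simp: centered_monomial_def card_Diff_subset)
    also have "Pow e = {S. S \<in> Pow (verts H) \<and> S \<subseteq> e}" using e by auto
    finally show "(if e \<subseteq> {x \<in> verts H. f x} then weight H e else 0) =
        (\<Sum>S | S \<in> Pow (verts H) \<and> S \<subseteq> e. weight H e * (p ^ (k - card S) * centered_monomial p S f))"
      by (simp add: sum_distrib_left)
  qed
  also have "\<dots> = (\<Sum>S\<in>Pow (verts H). \<Sum>e | e \<in> edges H \<and> S \<subseteq> e.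
        weight H e * (p ^ (k - card S) * centered_monomial p S f))"
    by (rule sum.swap_restrict) (use fin in auto)
  also have "\<dots> = (\<Sum>S\<in>Pow (verts H). p ^ (k - card S) * set_degree H S * centered_monomial p S f)"
    by (simp add: set_degree_def sum_distrib_left sum_distrib_right mult_ac)
  finally show ?thesis .
qed

text \<open>The empty set contributes exactly the subtracted mean, the singletons the linear main
  part, and all larger sets the remainder.\<close>

lemma deviation_decomposition:
  assumes H: "uniform_hypergraph k H"
  shows "deviation k p H {x \<in> verts H. f x} =
    (\<Sum>x\<in>verts H. p ^ (k - 1) * degree H x * (of_bool (f x) - p)) +
    (\<Sum>S | S \<subseteq> verts H \<and> 2 \<le> card S. p ^ (k - card S) * set_degree H S * centered_monomial p S f)"
proof -
  have fin: "finite (verts H)" using H by (auto simp: uniform_hypergraph_def)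
  let ?g = "\<lambda>S. p ^ (k - card S) * set_degree H S * centered_monomial p S f"
  let ?L = "{S. S \<subseteq> verts H \<and> 2 \<le> card S}" and ?V1 = "(\<lambda>x. {x}) ` verts H"
  have split: "Pow (verts H) = insert {} (?V1 \<union> ?L)"
  proof (intro equalityI subsetI)
    fix S assume S: "S \<in> Pow (verts H)"
    then have "finite S" using finite_subset[OF _ fin] by auto
    consider "S = {}" | "card S = 1" | "2 \<le> card S"
      using \<open>finite S\<close> by (metis One_nat_def Suc_1 card_eq_0_iff less_2_cases not_le)
    then show "S \<in> insert {} (?V1 \<union> ?L)"
    proof cases
      case 2
      then obtain x where "S = {x}" by (auto simp: card_1_singleton_iff)
      then show ?thesis using S by auto
    qed (use S in auto)
  qed auto
  have "sum ?g (Pow (verts H)) = ?g {} + (sum ?g ?V1 + sum ?g ?L)"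
  proof -
    have "finite ?V1" "finite ?L" "{} \<notin> ?V1 \<union> ?L" "?V1 \<inter> ?L = {}" using fin by auto
    then show ?thesis unfolding split by (simp only: sum.insert sum.union_disjoint finite_UnI not_False_eq_True)
  qed
  also have "sum ?g ?V1 = (\<Sum>x\<in>verts H. p ^ (k - 1) * degree H x * (of_bool (f x) - p))"
    by (subst sum.reindex) (auto simp: centered_monomial_def)
  also have "?g {} = p ^ k * total_weight H"
    by (simp add: centered_monomial_def set_degree_empty)
  finally show ?thesis
    by (simp add: deviation_def weight_within_decomposition[OF H, of f p])
qed

section \<open>Quantitative normal approximation\<close>

lemma set_degree_eq_0:
  assumes "uniform_hypergraph k H" "k < card S"
  shows "set_degree H S = 0"
proof -
  have "\<not> S \<subseteq> e" if "e \<in> edges H" for e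
    using assms that card_mono[of e S] finite_subset[of e "verts H"]
    unfolding uniform_hypergraph_def by fastforce
  then have "{e \<in> edges H. S \<subseteq> e} = {}" by blast
  then show ?thesis by (simp only: set_degree_def sum.empty)
qed

text \<open>For \<open>s \<le> r\<close> the left side is \<open>n ^ (r - 1)\<close> divided by
  \<open>(p * n) ^ (s - 1)\<close>, and \<open>p * n \<ge> 1\<close> yields the first term. For
  \<open>s > r\<close> the power of \<open>n\<close> is 1, and \<open>p \<le> 1\<close> allows
  raising \<open>s\<close> to \<open>k\<close>, which yields the second term.\<close>

lemma power_tradeoff:
  fixes n p :: real
  assumes "0 < p" "p \<le> 1" "1 \<le> p * n" "1 \<le> r" "2 \<le> s" "s \<le> k"
  shows "n ^ (r - s) * (1 / p) ^ (s - 1) \<le> n ^ (r - 1) * (1 / (p * n) + 1 / (p ^ (k - 1) * n ^ (r - 1)))"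
proof -
  have "0 < p * n" using assms(3) by linarith
  then have n: "0 < n" using assms(1) by (simp add: zero_less_mult_iff)
  show ?thesis
  proof (cases "s \<le> r")
    case True
    have "(1 / (p * n)) ^ (s - 1) \<le> (1 / (p * n)) ^ 1"
      using assms n by (intro power_decreasing) auto
    also have "\<dots> \<le> 1 / (p * n) + 1 / (p ^ (k - 1) * n ^ (r - 1))"
      using assms n by simp
    finally have "n ^ (r - 1) * (1 / (p * n)) ^ (s - 1) \<le>
        n ^ (r - 1) * (1 / (p * n) + 1 / (p ^ (k - 1) * n ^ (r - 1)))"
      using n by (intro mult_left_mono) auto
    moreover have "n ^ (r - 1) = n ^ (r - s) * n ^ (s - 1)"
      using True assms by (simp flip: power_add)
    ultimately show ?thesis using n by (simp add: power_mult_distrib power_divide)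
  next
    case False
    have "n ^ (r - s) * (1 / p) ^ (s - 1) = (1 / p) ^ (s - 1)" using False by simp
    also have "\<dots> \<le> (1 / p) ^ (k - 1)"
      using assms by (intro power_increasing) auto
    also have "\<dots> = n ^ (r - 1) * (1 / (p ^ (k - 1) * n ^ (r - 1)))"
      using n by (simp add: power_divide)
    also have "\<dots> \<le> n ^ (r - 1) * (1 / (p * n) + 1 / (p ^ (k - 1) * n ^ (r - 1)))"
      using n assms by (intro mult_left_mono) auto
    finally show ?thesis .
  qed
qed

text \<open>By orthogonality the second moment is a weighted sum of squared degrees. One factor of
  each square is bounded by the degree estimate, giving \<open>n ^ (r - 1)\<close>; the other is
  summed by double counting, giving \<open>n ^ r\<close>. The bound thus has the order of the linear
  part's variance times \<open>\<eta>\<close>.\<close>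

lemma remainder_second_moment:
  fixes H :: "'a weighted_hypergraph" and C p :: real and k r :: nat
  defines "n \<equiv> real (card (verts H))"
  defines "\<eta> \<equiv> 1 / (p * n) + 1 / (p ^ (k - 1) * n ^ (r - 1))"
  assumes H: "uniform_hypergraph k H" and r: "2 \<le> r" "r \<le> k" and C: "0 \<le> C"
    and deg: "\<And>R. R \<subseteq> verts H \<Longrightarrow> card R = r \<Longrightarrow> set_degree H R \<le> C"
    and p: "0 < p" "p \<le> 1" "1 \<le> p * n"
  shows "measure_pmf.expectation (bernoulli_product (verts H) p)
      (\<lambda>f. (\<Sum>S | S \<subseteq> verts H \<and> 2 \<le> card S. p ^ (k - card S) * set_degree H S * centered_monomial p S f)\<^sup>2)
    \<le> 2 ^ k * C\<^sup>2 * \<eta> * n ^ (2 * r - 1) * ((1 - p) * p ^ (2 * k - 1))"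
proof -
  let ?F = "{S. S \<subseteq> verts H \<and> 2 \<le> card S}" and ?q = "(1 - p) * p ^ (2 * k - 1)"
  have fin: "finite (verts H)" using H by (auto simp: uniform_hypergraph_def)
  have n: "0 \<le> n" by (simp add: n_def)
  have \<eta>: "0 \<le> \<eta>" using n p by (simp add: \<eta>_def)
  note d = set_degree_nonneg[OF H] set_degree_le[OF H r(2) C deg, folded n_def]
  have term_le: "(p ^ (k - card S) * set_degree H S)\<^sup>2 * (p * (1 - p)) ^ card S \<le>
      set_degree H S * (C * \<eta> * n ^ (r - 1) * ?q)" if S: "S \<in> ?F" for S
  proof (cases "card S \<le> k")
    case True
    let ?s = "card S" and ?d = "set_degree H S"
    have s: "2 \<le> ?s" "?s \<le> k" "S \<subseteq> verts H" using S True by auto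
    \<comment> \<open>This extracts the common factor \<open>p ^ (2 * k - 1)\<close>; the surplus
      \<open>p ^ (s - 1)\<close> becomes the \<open>(1 / p) ^ (s - 1)\<close> of the
      tradeoff.\<close>
    have "2 * k - 1 = 2 * (k - ?s) + ?s + (?s - 1)" using s by simp
    then have pow: "p ^ (2 * k - 1) = (p ^ (k - ?s))\<^sup>2 * p ^ ?s * p ^ (?s - 1)"
      by (simp only: power_add power_mult mult.commute[of 2])
    have "(p ^ (k - ?s) * ?d)\<^sup>2 * (p * (1 - p)) ^ ?s
        = (?d\<^sup>2 * ((p ^ (k - ?s))\<^sup>2 * p ^ ?s)) * (1 - p) ^ ?s"
      by (simp add: power_mult_distrib mult_ac)
    also have "\<dots> \<le> (?d\<^sup>2 * ((p ^ (k - ?s))\<^sup>2 * p ^ ?s)) * (1 - p) ^ 1"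
      using p s by (intro mult_left_mono power_decreasing) auto
    also have "\<dots> = ?d * ((?d * (1 / p) ^ (?s - 1)) * ?q)"
      using p unfolding pow by (simp add: power2_eq_square power_divide)
    also have "\<dots> \<le> ?d * ((C * \<eta> * n ^ (r - 1)) * ?q)"
    proof (intro mult_left_mono mult_right_mono)
      have "?d * (1 / p) ^ (?s - 1) \<le> (C * n ^ (r - ?s)) * (1 / p) ^ (?s - 1)"
        using d(2)[OF _ _ s(3)] p by (intro mult_right_mono) auto
      also have "\<dots> = C * (n ^ (r - ?s) * (1 / p) ^ (?s - 1))" by simp
      also have "\<dots> \<le> C * (n ^ (r - 1) * \<eta>)"
        unfolding \<eta>_def using p r s C by (intro mult_left_mono power_tradeoff) auto
      finally show "?d * (1 / p) ^ (?s - 1) \<le> C * \<eta> * n ^ (r - 1)" by (simp add: mult_ac)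
    qed (use d p in auto)
    finally show ?thesis .
  \<comment> \<open>No edge contains a set with more than \<open>k\<close> vertices, so the
    truncated exponent \<open>k - card S\<close> does no harm.\<close>
  qed (simp add: set_degree_eq_0[OF H])
  have "measure_pmf.expectation (bernoulli_product (verts H) p)
      (\<lambda>f. (\<Sum>S\<in>?F. p ^ (k - card S) * set_degree H S * centered_monomial p S f)\<^sup>2)
      = (\<Sum>S\<in>?F. (p ^ (k - card S) * set_degree H S)\<^sup>2 * (p * (1 - p)) ^ card S)"
    by (rule expectation_centered_polynomial_square) (use fin p in auto)
  also have "\<dots> \<le> (\<Sum>S\<in>?F. set_degree H S * (C * \<eta> * n ^ (r - 1) * ?q))"
    by (rule sum_mono) (rule term_le)
  also have "\<dots> = (\<Sum>S\<in>?F. set_degree H S) * (C * \<eta> * n ^ (r - 1) * ?q)"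
    by (simp only: sum_distrib_right)
  also have "\<dots> \<le> (2 ^ k * (C * n ^ r)) * (C * \<eta> * n ^ (r - 1) * ?q)"
  proof (rule mult_right_mono)
    have "(\<Sum>S\<in>?F. set_degree H S) \<le> (\<Sum>S\<in>Pow (verts H). set_degree H S)"
      using fin d(1) by (intro sum_mono2) auto
    also have "\<dots> = 2 ^ k * set_degree H {}"
      by (simp add: sum_set_degree[OF H] set_degree_empty)
    \<comment> \<open>The total weight is the degree of the empty set, so the degree estimate
      applies with exponent \<open>r\<close>.\<close>
    also have "\<dots> \<le> 2 ^ k * (C * n ^ r)"
      using d(2)[of "{}"] by simp
    finally show "(\<Sum>S\<in>?F. set_degree H S) \<le> 2 ^ k * (C * n ^ r)" .
  qed (use C \<eta> n p in auto)
  also have "\<dots> = 2 ^ k * C\<^sup>2 * \<eta> * (n ^ r * n ^ (r - 1)) * ?q"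
    by (simp add: power2_eq_square mult_ac)
  also have "n ^ r * n ^ (r - 1) = n ^ (2 * r - 1)"
    using r by (simp flip: power_add add: mult_2)
  finally show ?thesis .
qed

text \<open>Here \<open>s\<close> is exactly the standard deviation of the linear part, so that part
  has variance 1 after norming. The first two error terms come from its normal approximation with
  \<open>\<epsilon> = sqrt (2 * C ^ 3 * \<eta>)\<close>, the last from the remainder treated as a
  perturbation.\<close>

lemma char_normalized_deviation:
  fixes H :: "'a weighted_hypergraph" and C p s t :: real and k r :: nat
  defines "n \<equiv> real (card (verts H))"
  defines "\<eta> \<equiv> 1 / (p * n) + 1 / (p ^ (k - 1) * n ^ (r - 1))"
  defines "Q \<equiv> \<Sum>x\<in>verts H. (degree H x)\<^sup>2"
  assumes H: "uniform_hypergraph k H" and r: "2 \<le> r" "r \<le> k" and C: "0 < C"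
    and deg: "\<And>R. R \<subseteq> verts H \<Longrightarrow> card R = r \<Longrightarrow> set_degree H R \<le> C"
    and p: "0 < p" "p \<le> 1 / 2" "1 \<le> p * n"
    and Q: "n ^ (2 * r - 1) / C \<le> Q"
    and s: "0 < s" "s\<^sup>2 = (1 - p) * p ^ (2 * k - 1) * Q"
  shows "cmod (char (distr (measure_pmf (random_subset (verts H) p)) borel (\<lambda>B. deviation k p H B / s)) t
           - exp (- (t\<^sup>2 / 2)))
    \<le> \<bar>t\<bar> ^ 3 * sqrt (2 * C ^ 3 * \<eta>) / 6 + t ^ 4 * (2 * C ^ 3 * \<eta>) / 4 + \<bar>t\<bar> * sqrt (2 ^ k * C ^ 3 * \<eta>)"
proof -
  let ?M = "bernoulli_product (verts H) p"
  define a where "a x = p ^ (k - 1) * degree H x / s" for x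
  define X where "X f = (\<Sum>x\<in>verts H. a x * (of_bool (f x) - p))" for f
  define R where "R f = (\<Sum>S | S \<subseteq> verts H \<and> 2 \<le> card S.
      p ^ (k - card S) * set_degree H S * centered_monomial p S f)" for f
  have fin: "finite (verts H)" using H by (auto simp: uniform_hypergraph_def)
  have "0 < p * n" using p(3) by linarith
  then have n: "0 < n" using p(1) by (simp add: zero_less_mult_iff)
  have \<eta>: "0 \<le> \<eta>" "1 / (p * n) \<le> \<eta>" using n p by (simp_all add: \<eta>_def)
  have Q0: "0 < Q" using Q n C by (smt (verit) divide_pos_pos zero_less_power)
  have nQ: "n ^ (2 * r - 1) / Q \<le> C" using Q Q0 C by (simp add: field_simps)
  have pow: "p ^ (2 * k - 1) = (p ^ (k - 1))\<^sup>2 * p"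
  proof -
    have "2 * k - 1 = (k - 1) * 2 + 1" using r by simp
    then show ?thesis by (simp only: power_add power_mult power_one_right)
  qed
  have s2: "s\<^sup>2 = (p ^ (k - 1))\<^sup>2 * (p * (1 - p)) * Q" unfolding s(2) pow by simp
  have a2: "(a x)\<^sup>2 = (degree H x)\<^sup>2 / (p * (1 - p) * Q)" for x
    using p by (simp add: a_def power_divide power_mult_distrib s2)

  have "(\<Sum>x\<in>verts H. (a x)\<^sup>2 * (p * (1 - p))) = (\<Sum>x\<in>verts H. (degree H x)\<^sup>2 / Q)"
    using p by (simp add: a2)
  then have var: "(\<Sum>x\<in>verts H. (a x)\<^sup>2 * (p * (1 - p))) = 1"
    using Q0 by (simp add: Q_def flip: sum_divide_distrib)
  have small: "\<bar>a x\<bar> \<le> sqrt (2 * C ^ 3 * \<eta>)" if x: "x \<in> verts H" for x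
  proof (rule real_le_rsqrt)
    have "degree H x \<le> C * n ^ (r - 1)"
      using set_degree_le[OF H r(2) less_imp_le[OF C] deg, folded n_def, of "{x}"] x by simp
    then have "(degree H x)\<^sup>2 \<le> (C * n ^ (r - 1))\<^sup>2"
      using set_degree_nonneg[OF H] by (intro power_mono)
    also have "\<dots> = C\<^sup>2 * n ^ (2 * r - 1) / n"
    proof -
      have "2 * r - 1 = (r - 1) * 2 + 1" using r by simp
      then have "n ^ (2 * r - 1) = (n ^ (r - 1))\<^sup>2 * n"
        by (simp only: power_add power_mult power_one_right)
      then show ?thesis using n by (simp add: power_mult_distrib)
    qed
    finally have "(a x)\<^sup>2 \<le> (C\<^sup>2 * n ^ (2 * r - 1) / n) / (p * (1 - p) * Q)"
      unfolding a2 using p Q0 by (intro divide_right_mono) auto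
    also have "\<dots> = C\<^sup>2 * (n ^ (2 * r - 1) / Q) * (1 / (p * n)) * (1 / (1 - p))"
      by simp
    \<comment> \<open>The lower bound on \<open>Q\<close> supplies a third \<open>C\<close>, and
      \<open>p \<le> 1 / 2\<close> supplies the factor 2.\<close>
    also have "\<dots> \<le> C\<^sup>2 * C * \<eta> * 2"
      using p C n \<eta> nQ Q0 by (intro mult_mono) (auto simp: field_simps)
    finally show "\<bar>a x\<bar>\<^sup>2 \<le> 2 * C ^ 3 * \<eta>"
      by (simp add: power2_eq_square power3_eq_cube mult_ac)
  qed

  have "measure_pmf.expectation ?M (\<lambda>f. (R f / s)\<^sup>2) = measure_pmf.expectation ?M (\<lambda>f. (R f)\<^sup>2) / s\<^sup>2"
    by (simp add: power_divide)
  also have "\<dots> \<le> (2 ^ k * C\<^sup>2 * \<eta> * n ^ (2 * r - 1) * ((1 - p) * p ^ (2 * k - 1))) / s\<^sup>2"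
    unfolding R_def n_def \<eta>_def
    using p by (intro divide_right_mono remainder_second_moment[OF H r less_imp_le[OF C] deg])
      (auto simp: n_def)
  \<comment> \<open>Norming cancels all powers of \<open>p\<close> and \<open>1 - p\<close> outside
    \<open>\<eta>\<close>.\<close>
  also have "\<dots> = 2 ^ k * C\<^sup>2 * \<eta> * (n ^ (2 * r - 1) / Q)"
    using p by (simp add: s(2))
  also have "\<dots> \<le> 2 ^ k * C\<^sup>2 * \<eta> * C"
    using \<eta> nQ by (intro mult_left_mono) auto
  finally have rem: "measure_pmf.expectation ?M (\<lambda>f. (R f / s)\<^sup>2) \<le> 2 ^ k * C ^ 3 * \<eta>"
    by (simp add: power2_eq_square power3_eq_cube mult_ac)

  have "deviation k p H {x \<in> verts H. f x} / s = X f + R f / s" for f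
    by (simp add: deviation_decomposition[OF H] X_def R_def a_def add_divide_distrib sum_divide_distrib)
  then have "distr (measure_pmf (random_subset (verts H) p)) borel (\<lambda>B. deviation k p H B / s)
      = distr (measure_pmf ?M) borel (\<lambda>f. X f + R f / s)"
    unfolding random_subset_def map_pmf_rep_eq by (subst distr_distr) (auto simp: comp_def)
  moreover have "cmod (char (distr (measure_pmf ?M) borel (\<lambda>f. X f + R f / s)) t
      - char (distr (measure_pmf ?M) borel X) t) \<le> \<bar>t\<bar> * sqrt (2 ^ k * C ^ 3 * \<eta>)"
    using char_perturbation[OF finite_set_bernoulli_product[OF fin], of p X "\<lambda>f. R f / s" t]
    by (rule order_trans) (intro mult_left_mono real_sqrt_le_mono rem abs_ge_zero)
  moreover have "cmod (char (distr (measure_pmf ?M) borel X) t - exp (- (t\<^sup>2 / 2)))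
      \<le> \<bar>t\<bar> ^ 3 * sqrt (2 * C ^ 3 * \<eta>) / 6 + t ^ 4 * (2 * C ^ 3 * \<eta>) / 4"
    using char_weighted_bernoulli_sum[OF fin _ _ _ small var, of t] p C \<eta>(1)
    unfolding X_def by simp
  ultimately show ?thesis
    using norm_diff_triangle_le by (fastforce simp: add.commute)
qed

section \<open>The limit\<close>

text \<open>With \<open>q\<close> the ratio assumed to vanish, the two summands are eventually at
  most \<open>q\<close> and \<open>q ^ (k - 1)\<close>.\<close>

lemma sparsity_tendsto_0:
  fixes p :: "nat \<Rightarrow> real"
  assumes r: "2 \<le> r" "r \<le> k"
    and p: "\<forall>\<^sub>F N in sequentially. 0 < p N"
    and lim: "(\<lambda>N. (ln (real N) / real N) powr ((real r - 1) / (real k - 1)) / p N) \<longlonglongrightarrow> 0"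
  shows "(\<lambda>N. 1 / (p N * real N) + 1 / (p N ^ (k - 1) * real N ^ (r - 1))) \<longlonglongrightarrow> 0"
proof -
  let ?a = "(real r - 1) / (real k - 1)"
  let ?q = "\<lambda>N. (ln (real N) / real N) powr ?a / p N"
  have a: "0 < ?a" "?a \<le> 1" using r by auto
  have bound: "\<forall>\<^sub>F N in sequentially. 0 \<le> 1 / (p N * real N) + 1 / (p N ^ (k - 1) * real N ^ (r - 1)) \<and>
      1 / (p N * real N) + 1 / (p N ^ (k - 1) * real N ^ (r - 1)) \<le> ?q N + ?q N ^ (k - 1)"
    using p eventually_ge_at_top[of 3]
  proof eventually_elim
    case (elim N)
    \<comment> \<open>The threshold 3 exceeds Euler's number, which ensures
      \<open>ln N \<ge> 1\<close>.\<close>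
    have "exp 1 \<le> real N" using elim(2) exp_le by linarith
    then have ln: "1 \<le> ln (real N)" using elim(2) by (subst ln_ge_iff) auto
    then have L: "1 / real N \<le> ln (real N) / real N" by (intro divide_right_mono) auto
    have L1: "0 < ln (real N) / real N" "ln (real N) / real N \<le> 1"
      using ln ln_le_minus_one[of "real N"] elim(2) by (auto simp: field_simps)
    have "1 / real N \<le> (ln (real N) / real N) powr 1"
      using L unfolding powr_one[OF less_imp_le[OF L1(1)]] .
    \<comment> \<open>The base is at most 1, so lowering the exponent from 1 to
      \<open>(r - 1) / (k - 1)\<close> can only increase the power.\<close>
    also have "\<dots> \<le> (ln (real N) / real N) powr ?a"
      using a L1 by (intro powr_mono') auto
    finally have 1: "1 / real N / p N \<le> ?q N" using elim by (intro divide_right_mono) auto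
    \<comment> \<open>The power \<open>k - 1\<close> clears the denominator of the exponent.\<close>
    have "((ln (real N) / real N) powr ?a) ^ (k - 1) = (ln (real N) / real N) ^ (r - 1)"
    proof -
      have "((ln (real N) / real N) powr ?a) ^ (k - 1) = (ln (real N) / real N) powr (real r - 1)"
      proof -
        have "real (k - 1) * ?a = real r - 1" using r by (simp add: of_nat_diff)
        moreover have "((ln (real N) / real N) powr ?a) ^ (k - 1) = (ln (real N) / real N) powr (real (k - 1) * ?a)"
          by (rule powr_power) (rule less_imp_neq[OF L1(1), THEN not_sym])
        ultimately show ?thesis by simp
      qed
      also have "\<dots> = (ln (real N) / real N) ^ (r - 1)"
        using powr_realpow[OF L1(1), of "r - 1"] r by (simp add: of_nat_diff)
      finally show ?thesis .
    qed
    moreover have "(1 / real N) ^ (r - 1) \<le> (ln (real N) / real N) ^ (r - 1)"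
      by (rule power_mono[OF L]) simp
    ultimately have "(1 / real N) ^ (r - 1) \<le> ((ln (real N) / real N) powr ?a) ^ (k - 1)"
      by (simp only:)
    then have "(1 / real N) ^ (r - 1) / p N ^ (k - 1) \<le> ?q N ^ (k - 1)"
      using elim unfolding power_divide[of _ "p N"] by (intro divide_right_mono) auto
    then show ?case using 1 elim by (simp add: power_divide mult.commute)
  qed
  have "(\<lambda>N. ?q N + ?q N ^ (k - 1)) \<longlonglongrightarrow> 0 + 0 ^ (k - 1)"
    by (rule tendsto_add[OF lim tendsto_power[OF lim]])
  then have "(\<lambda>N. ?q N + ?q N ^ (k - 1)) \<longlonglongrightarrow> 0" using r by (simp add: power_0_left)
  from tendsto_const this show ?thesis
    by (rule tendsto_sandwich[rotated 2]) (rule eventually_mono[OF bound], simp)+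
qed

lemma constant_sparsity_tendsto_0:
  fixes c :: real
  assumes "2 \<le> r" "0 < c"
  shows "(\<lambda>N. 1 / (c * real N) + 1 / (c ^ (k - 1) * real N ^ (r - 1))) \<longlonglongrightarrow> 0"
proof -
  have *: "(\<lambda>N. 1 / (b * real N ^ m)) \<longlonglongrightarrow> 0" if "0 < b" "0 < m" for b m
    using that
    by (intro tendsto_divide_0[OF tendsto_const] filterlim_at_top_imp_at_infinity
        filterlim_tendsto_pos_mult_at_top[OF tendsto_const] filterlim_pow_at_top filterlim_real_sequentially)
  show ?thesis
    using tendsto_add[OF *[of c 1] *[of "c ^ (k - 1)" "r - 1"]] assms by simp
qed

theorem theorem1p5:
  fixes r k C :: nat
    and H :: "nat \<Rightarrow> nat weighted_hypergraph"
    and p :: "nat \<Rightarrow> real"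
  assumes "2 \<le> r" and "r \<le> k" and "1 \<le> C"
    and "\<forall>\<^sub>F N in sequentially. uniform_hypergraph k (H N) \<and> verts (H N) = {1..N}"
    and "\<forall>\<^sub>F N in sequentially. max_degree r (H N) \<le> real C"
    and "\<forall>\<^sub>F N in sequentially. degree_variance (H N) \<ge> real N ^ (2 * r - 2) / real C"
    and "\<forall>\<^sub>F N in sequentially. 0 < p N \<and> p N < 1 / 2"
    and "(\<exists>c. 0 < c \<and> c < 1 / 2 \<and> (\<forall>\<^sub>F N in sequentially. p N = c)) \<or>
         (p \<longlonglongrightarrow> 0 \<and>
          (\<lambda>N. (ln (real N) / real N) powr ((real r - 1) / (real k - 1)) / p N) \<longlonglongrightarrow> 0)"
  shows "weak_conv_m
           (\<lambda>N. distr (measure_pmf (random_subset {1..N} (p N))) borel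
              (\<lambda>B. deviation k (p N) (H N) B /
                   (sqrt (1 - p N) * p N powr (real k - 1 / 2) *
                    sqrt ((avg_degree (H N))\<^sup>2 + degree_variance (H N)) * sqrt (real N))))
           std_normal_distribution"
proof -
  let ?s = "\<lambda>N. sqrt (1 - p N) * p N powr (real k - 1 / 2) *
                    sqrt ((avg_degree (H N))\<^sup>2 + degree_variance (H N)) * sqrt (real N)"
  let ?D = "\<lambda>N. distr (measure_pmf (random_subset {1..N} (p N))) borel
              (\<lambda>B. deviation k (p N) (H N) B / ?s N)"
  define \<eta> where "\<eta> N = 1 / (p N * real N) + 1 / (p N ^ (k - 1) * real N ^ (r - 1))" for N
  have p: "\<forall>\<^sub>F N in sequentially. 0 < p N" using assms(7) by (auto elim: eventually_mono)
  have \<eta>: "\<eta> \<longlonglongrightarrow> 0"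
    using assms(8)
  proof (elim disjE exE conjE)
    fix c :: real assume c: "0 < c" "\<forall>\<^sub>F N in sequentially. p N = c"
    have "\<eta> N = 1 / (c * real N) + 1 / (c ^ (k - 1) * real N ^ (r - 1))" if "p N = c" for N
      using that by (simp add: \<eta>_def)
    then have *: "\<forall>\<^sub>F N in sequentially. \<eta> N = 1 / (c * real N) + 1 / (c ^ (k - 1) * real N ^ (r - 1))"
      using c(2) by (auto elim: eventually_mono)
    show ?thesis
      unfolding tendsto_cong[OF *] by (rule constant_sparsity_tendsto_0[OF assms(1) c(1)])
  next
    assume "(\<lambda>N. (ln (real N) / real N) powr ((real r - 1) / (real k - 1)) / p N) \<longlonglongrightarrow> 0"
    then show ?thesis
      unfolding \<eta>_def by (rule sparsity_tendsto_0[OF assms(1,2) p])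
  qed
  have char: "(\<lambda>N. char (?D N) t) \<longlonglongrightarrow> exp (- (t\<^sup>2 / 2))" for t
  proof -
    let ?b = "\<lambda>N. \<bar>t\<bar> ^ 3 * sqrt (2 * real C ^ 3 * \<eta> N) / 6 + t ^ 4 * (2 * real C ^ 3 * \<eta> N) / 4
        + \<bar>t\<bar> * sqrt (2 ^ k * real C ^ 3 * \<eta> N)"
    have "?b \<longlonglongrightarrow> \<bar>t\<bar> ^ 3 * sqrt (2 * real C ^ 3 * 0) / 6 + t ^ 4 * (2 * real C ^ 3 * 0) / 4
        + \<bar>t\<bar> * sqrt (2 ^ k * real C ^ 3 * 0)"
      by (intro tendsto_intros \<eta>) auto
    then have b: "?b \<longlonglongrightarrow> 0" by simp
    \<comment> \<open>Since \<open>1 / (p N * N) \<le> \<eta> N\<close>, this gives the condition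
      \<open>1 \<le> p N * N\<close> of the quantitative bound.\<close>
    have "\<forall>\<^sub>F N in sequentially. \<eta> N < 1" using \<eta> by (rule order_tendstoD) simp
    with assms(4-7) eventually_ge_at_top[of r]
    have "\<forall>\<^sub>F N in sequentially. norm (char (?D N) t - exp (- (t\<^sup>2 / 2))) \<le> ?b N"
    proof eventually_elim
      case (elim N)
      then have H: "uniform_hypergraph k (H N)" and V: "verts (H N) = {1..N}"
        and p: "0 < p N" "p N < 1 / 2" by auto
      have N: "0 < real N" "card (verts (H N)) = N" using elim assms(1) V by auto
      have "1 / (p N * real N) \<le> \<eta> N" using p N by (simp add: \<eta>_def)
      then have "1 / (p N * real N) < 1" using elim by linarith
      then have pN: "1 \<le> p N * real N" using p N by (simp add: divide_less_eq)
      have deg: "set_degree (H N) R \<le> real C" if "R \<subseteq> verts (H N)" "card R = r" for R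
      proof -
        have "set_degree (H N) R \<le> max_degree r (H N)"
          unfolding max_degree_def using that V by (intro Max_ge) auto
        then show ?thesis using elim by linarith
      qed
      let ?w = "(avg_degree (H N))\<^sup>2 + degree_variance (H N)"
      have Q: "(\<Sum>x\<in>verts (H N). (degree (H N) x)\<^sup>2) = real N * ?w"
        using sum_degree_square[of "H N"] N V by force
      \<comment> \<open>The squared mean is nonnegative, so the variance bound passes to the sum;
        multiplying by \<open>N\<close> then raises the exponent to
        \<open>2 * r - 1\<close>.\<close>
      have w: "real N ^ (2 * r - 2) / real C \<le> ?w" using elim by (simp add: add_increasing)
      moreover have "0 < real N ^ (2 * r - 2) / real C" using N assms(3) by simp
      ultimately have w0: "0 < ?w" by linarith
      have "2 * r - 1 = Suc (2 * r - 2)" using assms(1) by simp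
      then have Q2: "real N ^ (2 * r - 1) / real C \<le> (\<Sum>x\<in>verts (H N). (degree (H N) x)\<^sup>2)"
        using mult_left_mono[OF w, of "real N"] unfolding Q by simp
      have s0: "0 < ?s N" using p N w0 by simp
      \<comment> \<open>Squaring turns the half-integer exponent of the norming factor into the
        natural number \<open>2 * k - 1\<close>.\<close>
      have "(p N powr (real k - 1 / 2))\<^sup>2 = p N powr real (2 * k - 1)"
        using p assms(1,2) by (simp add: powr_power of_nat_diff algebra_simps)
      also have "\<dots> = p N ^ (2 * k - 1)" using p by (simp only: powr_realpow)
      finally have s2: "(?s N)\<^sup>2 = (1 - p N) * p N ^ (2 * k - 1) * (\<Sum>x\<in>verts (H N). (degree (H N) x)\<^sup>2)"
        using p N w0 by (simp add: power_mult_distrib Q)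
      have C: "0 < real C" using assms(3) by simp
      show ?case
        by (rule char_normalized_deviation[where k = k and H = "H N" and r = r and C = "real C" and p = "p N"
            and s = "?s N" and t = t, unfolded N(2), folded \<eta>_def,
            OF H assms(1,2) C deg p(1) less_imp_le[OF p(2)] pN Q2 s0 s2, unfolded V])
    qed
    then have "(\<lambda>N. char (?D N) t - exp (- (t\<^sup>2 / 2))) \<longlonglongrightarrow> 0"
      using b by (rule Lim_null_comparison)
    then show ?thesis by (rule LIM_zero_cancel)
  qed
  \<comment> \<open>Levy's continuity theorem turns pointwise convergence of characteristic
    functions into weak convergence.\<close>
  show ?thesis
  proof (rule levy_continuity)
    show "real_distribution (?D N)" for N
      by (intro prob_space.real_distribution_distr measure_pmf.prob_space_axioms) simp
    show "real_distribution std_normal_distribution"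
      by (rule real_dist_normal_dist)
    show "(\<lambda>N. char (?D N) t) \<longlonglongrightarrow> char std_normal_distribution t" for t
      using char[of t] by (simp add: char_std_normal_distribution)
  qed
qed

end
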